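(* The functor $Ext_g\circ S_g:\mathbf{Graded\ Frm}^{op}\to\mathbf{Graded\ Fuzzy\ Top}$ is right adjoint to the functor $fm_g\circ J_g:\mathbf{Graded\ Fuzzy\ Top}\to\mathbf{Graded\ Frm}^{op}$.
   Context: Gödel arrow on $[0,1]$: $a\to b=1$ if $a\le b$, $a\to b=b$ if $a>b$. In $[0,1]$, $\wedge$ is minimum. $\mathbf{Graded\ Fuzzy\ Top}$: objects are fuzzy topological spaces with graded inclusion $(X,\tau,\subseteq)$, where $X$ is a set, $\tau$ is a collection of maps $X\to[0,1]$ containing the constants $0$ and $1$ and closed under arbitrary pointwise suprema ($\bigcup$) and binary pointwise minima ($\cap$), and $\subseteq$ is the fuzzy relation $gr(\tilde T_1\subseteq\tilde T_2)=\inf_{x\in X}\{\tilde T_1(x)\to\tilde T_2(x)\}$. A morphism $(X,\tau,\subseteq)\to(Y,\tau',\subseteq)$ is a function $f:X\to Y$ with $f^{-1}(\tilde T'):=\tilde T'\circ f\in\tau$ for all $\tilde T'\in\tau'$. A graded frame $(A,R)$ is a 5-tuple $(A,\top,\wedge,\bigvee,R)$ with $A$ a non-empty set, $\top\in A$, $\wedge$ a binary operation, $\bigvee$ an operation on arbitrary subsets of $A$, and $R:A\times A\to[0,1]$ such that for all $a,b,c\in A$, $S\subseteq A$: (1) $R(a,a)=1$; (2) $R(a,b)=1=R(b,a)$ implies $a=b$; (3) $R(a,b)\wedge R(b,c)\le R(a,c)$; (4) $R(a\wedge b,a)=1=R(a\wedge b,b)$; (5) $R(a,\top)=1$; (6)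 $R(a,b)\wedge R(a,c)=R(a,b\wedge c)$; (7) $R(a,\bigvee S)=1$ if $a\in S$; (8) $\inf\{R(a,b)\mid a\in S\}=R(\bigvee S,b)$; (9) $R(a\wedge\bigvee S,\bigvee\{a\wedge b\mid b\in S\})=1$. $\mathbf{Graded\ Frm}$ has graded frames as objects and graded frame homomorphisms as morphisms: maps $f:(A,R)\to(B,R')$ with $f(a_1\wedge a_2)=f(a_1)\wedge f(a_2)$, $f(\bigvee_i a_i)=\bigvee_i f(a_i)$ and $R(a_1,a_2)\le R'(f(a_1),f(a_2))$. $\mathbf{Graded\ Fuzzy\ TopSys}$: objects are graded fuzzy topological systems $(X,\models,A,R)$, with $X$ a non-empty set, $(A,R)$ a graded frame and $\models$ a function $(x,a)\mapsto gr(x\models a)\in[0,1]$ such that (1) $gr(x\models a)\wedge R(a,b)\le gr(x\models b)$; (2) $gr(x\models\bigwedge S)=\inf\{gr(x\models a)\mid a\in S\}$ for finite $S\subseteq A$, including $S=\emptyset$ (where $\bigwedge\emptyset=\top$, $\inf\emptyset=1$); (3) $gr(x\models\bigvee S)=\sup\{gr(x\models a)\mid a\in S\}$ for every $S\subseteq A$ (with $\sup\emptyset=0$). A morphism $(X,\models,A,R)\to(Y,\models',B,R')$ is a pair $(f_1,f_2)$ with $f_1:X\to Y$ a function, $f_2:(B,R')\to(A,R)$ a graded frame homomorphism and $gr(x\models f_2(b))=gr(f_1(x)\models'b)$ for all $x\in X,b\in B$. Composition is $(g_1,g_2)\circ(f_1,f_2)=(g_1\circ f_1,f_2\circ g_2)$.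 Functors: $Ext_g(X,\models,A,R)=(X,ext_g(A),\subseteq)$ with $ext_g(A)=\{ext_g(a):a\in A\}$, $ext_g(a)(x)=gr(x\models a)$, and $Ext_g(f_1,f_2)=f_1$. $J_g(X,\tau,\subseteq)=(X,\in,\tau,\subseteq)$ with $gr(x\in\tilde T)=\tilde T(x)$ (here $(\tau,\subseteq)$ is a graded frame under $\cap,\bigcup$ with top the constant $1$), and $J_g(f)=(f,f^{-1})$. $fm_g(X,\models,A,R)=(A,R)$, $fm_g(f_1,f_2)=f_2$ (into $\mathbf{Graded\ Frm}^{op}$). $S_g((A,R))=(Hom_g((A,R),([0,1],R^* )),\models_*,A,R)$, where $R^*(a,b)=a\to b$, $([0,1],R^* )$ carries minimum, supremum and top $1$, $Hom_g((A,R),([0,1],R^* ))$ is the set of graded frame homomorphisms $v:(A,R)\to([0,1],R^* )$, $gr(v\models_*a)=v(a)$, and $S_g(f)=(\_\circ f,f)$ (from $\mathbf{Graded\ Frm}^{op}$), where $\_\circ f$ is $v\mapsto v\circ f$.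
   Formalization: Graded frame homomorphisms are also required to preserve ⊤ (otherwise the constant-0 map is a point and S_g violates axiom (2) at S=∅), and systems may have an empty set X (needed for S_g of the one-element frame and J_g of the empty space). *)

theory Defs
  imports Complex_Main "HOL-Library.FuncSet"
begin

text \<open>The value set $[0,1]$, as a complete chain: \<open>top\<close> is 1, \<open>bot\<close> is 0, and, unlike on the
  type of reals, the infimum and supremum of the empty set are 1 and 0.\<close>

typedef unit_interval = "{0..1::real}"
  by auto

instantiation unit_interval :: complete_linorder
begin

definition less_eq_unit_interval :: "unit_interval \<Rightarrow> unit_interval \<Rightarrow> bool" where
  "a \<le> b \<longleftrightarrow> Rep_unit_interval a \<le> Rep_unit_interval b"

definition less_unit_interval :: "unit_interval \<Rightarrow> unit_interval \<Rightarrow> bool" where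
  "a < b \<longleftrightarrow> Rep_unit_interval a < Rep_unit_interval b"

definition inf_unit_interval :: "unit_interval \<Rightarrow> unit_interval \<Rightarrow> unit_interval" where
  "inf (a :: unit_interval) b = (if a \<le> b then a else b)"

definition sup_unit_interval :: "unit_interval \<Rightarrow> unit_interval \<Rightarrow> unit_interval" where
  "sup (a :: unit_interval) b = (if a \<le> b then b else a)"

definition bot_unit_interval :: unit_interval where
  "bot = Abs_unit_interval 0"

definition top_unit_interval :: unit_interval where
  "top = Abs_unit_interval 1"

definition Inf_unit_interval :: "unit_interval set \<Rightarrow> unit_interval" where
  "Inf S = Abs_unit_interval (Inf (insert 1 (Rep_unit_interval ` S)))"

definition Sup_unit_interval :: "unit_interval set \<Rightarrow> unit_interval" where
  "Sup S = Abs_unit_interval (Sup (insert 0 (Rep_unit_interval ` S)))"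

instance
proof -
  have R01: "0 \<le> Rep_unit_interval a" "Rep_unit_interval a \<le> 1" for a
    using Rep_unit_interval[of a] by auto
  have below: "bdd_below (insert 1 (Rep_unit_interval ` S))" for S
    by (rule bdd_belowI[of _ 0]) (use R01 in auto)
  have above: "bdd_above (insert 0 (Rep_unit_interval ` S))" for S
    by (rule bdd_aboveI[of _ 1]) (use R01 in auto)
  have RInf: "Rep_unit_interval (Inf S) = Inf (insert 1 (Rep_unit_interval ` S))" for S
    unfolding Inf_unit_interval_def
    by (rule Abs_unit_interval_inverse)
      (use R01 in \<open>auto intro!: cInf_greatest cInf_lower below\<close>)
  have RSup: "Rep_unit_interval (Sup S) = Sup (insert 0 (Rep_unit_interval ` S))" for S
    unfolding Sup_unit_interval_def
    by (rule Abs_unit_interval_inverse)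
      (use R01 in \<open>auto intro!: cSup_least cSup_upper above\<close>)
  have Inf_lower': "Inf S \<le> a" if "a \<in> S" for S and a :: unit_interval
    unfolding less_eq_unit_interval_def RInf using that by (auto intro!: cInf_lower below)
  have Inf_greatest': "b \<le> Inf S" if "\<And>a. a \<in> S \<Longrightarrow> b \<le> a" for S and b :: unit_interval
    unfolding less_eq_unit_interval_def RInf
    using that R01 by (auto intro!: cInf_greatest simp: less_eq_unit_interval_def)
  have Sup_upper': "a \<le> Sup S" if "a \<in> S" for S and a :: unit_interval
    unfolding less_eq_unit_interval_def RSup using that by (auto intro!: cSup_upper above)
  have Sup_least': "Sup S \<le> b" if "\<And>a. a \<in> S \<Longrightarrow> a \<le> b" for S and b :: unit_interval
    unfolding less_eq_unit_interval_def RSup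
    using that R01 by (auto intro!: cSup_least simp: less_eq_unit_interval_def)
  have R0: "Rep_unit_interval bot = 0" and R1: "Rep_unit_interval top = 1"
    by (auto simp: bot_unit_interval_def top_unit_interval_def Abs_unit_interval_inverse)
  have antisym': "a = b" if "a \<le> b" "b \<le> a" for a b :: unit_interval
    using that by (simp add: less_eq_unit_interval_def Rep_unit_interval_inject[symmetric])
  have bounds: "bot \<le> a" "a \<le> top" for a :: unit_interval
    using R01 by (auto simp: less_eq_unit_interval_def R0 R1)
  show "OFCLASS(unit_interval, complete_linorder_class)"
  proof intro_classes
    show "Inf ({} :: unit_interval set) = top" "Sup ({} :: unit_interval set) = bot"
      by (auto intro!: antisym' Inf_greatest' Sup_least' bounds)
  qed (auto simp: less_eq_unit_interval_def less_unit_interval_def inf_unit_interval_def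
        sup_unit_interval_def Rep_unit_interval_inject
        intro: Inf_lower'[unfolded less_eq_unit_interval_def]
          Inf_greatest'[unfolded less_eq_unit_interval_def]
          Sup_upper'[unfolded less_eq_unit_interval_def]
          Sup_least'[unfolded less_eq_unit_interval_def])
qed

end

definition godel_arrow :: "unit_interval \<Rightarrow> unit_interval \<Rightarrow> unit_interval" where
  "godel_arrow a b = (if a \<le> b then top else b)"


section \<open>Categories and functors\<close>

text \<open>Homs need not be disjoint, so composition and the arrow part of a functor take the
  relevant objects as arguments: \<open>compos C X Y Z g f\<close> is the composite of \<open>f\<close> from \<open>X\<close> to \<open>Y\<close>
  with \<open>g\<close> from \<open>Y\<close> to \<open>Z\<close>.\<close>

record ('o, 'm) precategory =
  obj :: "'o set"
  hom :: "'o \<Rightarrow> 'o \<Rightarrow> 'm set"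
  ident :: "'o \<Rightarrow> 'm"
  compos :: "'o \<Rightarrow> 'o \<Rightarrow> 'o \<Rightarrow> 'm \<Rightarrow> 'm \<Rightarrow> 'm"

definition is_category :: "('o, 'm) precategory \<Rightarrow> bool" where
  "is_category C \<longleftrightarrow>
    (\<forall>X\<in>obj C. ident C X \<in> hom C X X) \<and>
    (\<forall>X\<in>obj C. \<forall>Y\<in>obj C. \<forall>Z\<in>obj C. \<forall>f\<in>hom C X Y. \<forall>g\<in>hom C Y Z.
      compos C X Y Z g f \<in> hom C X Z) \<and>
    (\<forall>X\<in>obj C. \<forall>Y\<in>obj C. \<forall>f\<in>hom C X Y.
      compos C X X Y f (ident C X) = f \<and> compos C X Y Y (ident C Y) f = f) \<and>
    (\<forall>W\<in>obj C. \<forall>X\<in>obj C. \<forall>Y\<in>obj C. \<forall>Z\<in>obj C.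
      \<forall>f\<in>hom C W X. \<forall>g\<in>hom C X Y. \<forall>h\<in>hom C Y Z.
        compos C W X Z (compos C X Y Z h g) f = compos C W Y Z h (compos C W X Y g f))"

definition op_cat :: "('o, 'm) precategory \<Rightarrow> ('o, 'm) precategory" where
  "op_cat C = \<lparr>obj = obj C, hom = (\<lambda>X Y. hom C Y X), ident = ident C,
    compos = (\<lambda>X Y Z g f. compos C Z Y X f g)\<rparr>"

record ('o, 'm, 'p, 'n) prefunctor =
  omap :: "'o \<Rightarrow> 'p"
  amap :: "'o \<Rightarrow> 'o \<Rightarrow> 'm \<Rightarrow> 'n"

definition is_functor ::
    "('o, 'm) precategory \<Rightarrow> ('p, 'n) precategory \<Rightarrow> ('o, 'm, 'p, 'n) prefunctor \<Rightarrow> bool" where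
  "is_functor C D F \<longleftrightarrow>
    is_category C \<and> is_category D \<and>
    (\<forall>X\<in>obj C. omap F X \<in> obj D) \<and>
    (\<forall>X\<in>obj C. \<forall>Y\<in>obj C. \<forall>f\<in>hom C X Y. amap F X Y f \<in> hom D (omap F X) (omap F Y)) \<and>
    (\<forall>X\<in>obj C. amap F X X (ident C X) = ident D (omap F X)) \<and>
    (\<forall>X\<in>obj C. \<forall>Y\<in>obj C. \<forall>Z\<in>obj C. \<forall>f\<in>hom C X Y. \<forall>g\<in>hom C Y Z.
      amap F X Z (compos C X Y Z g f) =
        compos D (omap F X) (omap F Y) (omap F Z) (amap F Y Z g) (amap F X Y f))"

definition functor_comp ::
    "('p, 'n, 'q, 'l) prefunctor \<Rightarrow> ('o, 'm, 'p, 'n) prefunctor \<Rightarrow> ('o, 'm, 'q, 'l) prefunctor"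
    (infixr "\<circ>\<^sub>F" 55) where
  "G \<circ>\<^sub>F F = \<lparr>omap = (\<lambda>X. omap G (omap F X)),
    amap = (\<lambda>X Y f. amap G (omap F X) (omap F Y) (amap F X Y f))\<rparr>"


section \<open>Graded frames\<close>

text \<open>All maps between carriers, fuzzy sets included, are extensional (\<open>undefined\<close> outside
  their domain), so that equality of morphisms is equality on the domain.\<close>

record 'a gframe =
  fcarrier :: "'a set"
  ftop :: 'a
  fmeet :: "'a \<Rightarrow> 'a \<Rightarrow> 'a"
  fjoin :: "'a set \<Rightarrow> 'a"
  frel :: "'a \<Rightarrow> 'a \<Rightarrow> unit_interval"

definition graded_frame :: "'a gframe \<Rightarrow> bool" where
  "graded_frame A \<longleftrightarrow>
    ftop A \<in> fcarrier A \<and>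
    (\<forall>a\<in>fcarrier A. \<forall>b\<in>fcarrier A. fmeet A a b \<in> fcarrier A) \<and>
    (\<forall>S. S \<subseteq> fcarrier A \<longrightarrow> fjoin A S \<in> fcarrier A) \<and>
    (\<forall>a\<in>fcarrier A. frel A a a = top) \<and>
    (\<forall>a\<in>fcarrier A. \<forall>b\<in>fcarrier A. frel A a b = top \<and> frel A b a = top \<longrightarrow> a = b) \<and>
    (\<forall>a\<in>fcarrier A. \<forall>b\<in>fcarrier A. \<forall>c\<in>fcarrier A.
      min (frel A a b) (frel A b c) \<le> frel A a c) \<and>
    (\<forall>a\<in>fcarrier A. \<forall>b\<in>fcarrier A.
      frel A (fmeet A a b) a = top \<and> frel A (fmeet A a b) b = top) \<and>
    (\<forall>a\<in>fcarrier A. frel A a (ftop A) = top) \<and>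
    (\<forall>a\<in>fcarrier A. \<forall>b\<in>fcarrier A. \<forall>c\<in>fcarrier A.
      min (frel A a b) (frel A a c) = frel A a (fmeet A b c)) \<and>
    (\<forall>S. S \<subseteq> fcarrier A \<longrightarrow> (\<forall>a\<in>S. frel A a (fjoin A S) = top)) \<and>
    (\<forall>S. S \<subseteq> fcarrier A \<longrightarrow> (\<forall>b\<in>fcarrier A. (INF a\<in>S. frel A a b) = frel A (fjoin A S) b)) \<and>
    (\<forall>S. S \<subseteq> fcarrier A \<longrightarrow> (\<forall>a\<in>fcarrier A.
      frel A (fmeet A a (fjoin A S)) (fjoin A ((\<lambda>b. fmeet A a b) ` S)) = top))"

text \<open>Homomorphisms preserve all finite meets, the empty one (the top element) included.
  Without this the constant-0 map would be a homomorphism into $[0,1]$, and the points of a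
  graded frame would not form a graded fuzzy topological system.\<close>

definition frm_hom :: "'a gframe \<Rightarrow> 'b gframe \<Rightarrow> ('a \<Rightarrow> 'b) set" where
  "frm_hom A B = {f \<in> fcarrier A \<rightarrow>\<^sub>E fcarrier B.
    f (ftop A) = ftop B \<and>
    (\<forall>a\<in>fcarrier A. \<forall>b\<in>fcarrier A. f (fmeet A a b) = fmeet B (f a) (f b)) \<and>
    (\<forall>S. S \<subseteq> fcarrier A \<longrightarrow> f (fjoin A S) = fjoin B (f ` S)) \<and>
    (\<forall>a\<in>fcarrier A. \<forall>b\<in>fcarrier A. frel A a b \<le> frel B (f a) (f b))}"

definition Graded_Frm :: "('a gframe, 'a \<Rightarrow> 'a) precategory" where
  "Graded_Frm = \<lparr>obj = {A. graded_frame A}, hom = frm_hom,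
    ident = (\<lambda>A. \<lambda>a\<in>fcarrier A. a),
    compos = (\<lambda>A B C g f. compose (fcarrier A) g f)\<rparr>"

definition unit_frame :: "unit_interval gframe" where
  "unit_frame = \<lparr>fcarrier = UNIV, ftop = top, fmeet = min, fjoin = Sup, frel = godel_arrow\<rparr>"


section \<open>Fuzzy topological spaces with graded inclusion\<close>

text \<open>The graded inclusion is determined by the underlying set, so it is not a field of the
  record.\<close>

record 'x fspace =
  spts :: "'x set"
  sopens :: "('x \<Rightarrow> unit_interval) set"

definition graded_incl ::
    "'x set \<Rightarrow> ('x \<Rightarrow> unit_interval) \<Rightarrow> ('x \<Rightarrow> unit_interval) \<Rightarrow> unit_interval" where
  "graded_incl X T\<^sub>1 T\<^sub>2 = (INF x\<in>X. godel_arrow (T\<^sub>1 x) (T\<^sub>2 x))"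

definition fuzzy_inter ::
    "'x set \<Rightarrow> ('x \<Rightarrow> unit_interval) \<Rightarrow> ('x \<Rightarrow> unit_interval) \<Rightarrow> 'x \<Rightarrow> unit_interval" where
  "fuzzy_inter X T\<^sub>1 T\<^sub>2 = (\<lambda>x\<in>X. min (T\<^sub>1 x) (T\<^sub>2 x))"

definition fuzzy_union :: "'x set \<Rightarrow> ('x \<Rightarrow> unit_interval) set \<Rightarrow> 'x \<Rightarrow> unit_interval" where
  "fuzzy_union X \<T> = (\<lambda>x\<in>X. SUP T\<in>\<T>. T x)"

definition fuzzy_space :: "'x fspace \<Rightarrow> bool" where
  "fuzzy_space X \<longleftrightarrow>
    sopens X \<subseteq> (spts X \<rightarrow>\<^sub>E UNIV) \<and>
    (\<lambda>x\<in>spts X. bot) \<in> sopens X \<and>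
    (\<lambda>x\<in>spts X. top) \<in> sopens X \<and>
    (\<forall>\<T>. \<T> \<subseteq> sopens X \<longrightarrow> fuzzy_union (spts X) \<T> \<in> sopens X) \<and>
    (\<forall>T\<^sub>1\<in>sopens X. \<forall>T\<^sub>2\<in>sopens X. fuzzy_inter (spts X) T\<^sub>1 T\<^sub>2 \<in> sopens X)"

definition top_hom :: "'x fspace \<Rightarrow> 'y fspace \<Rightarrow> ('x \<Rightarrow> 'y) set" where
  "top_hom X Y = {f \<in> spts X \<rightarrow>\<^sub>E spts Y. \<forall>T\<in>sopens Y. compose (spts X) T f \<in> sopens X}"

definition Graded_Fuzzy_Top :: "('x fspace, 'x \<Rightarrow> 'x) precategory" where
  "Graded_Fuzzy_Top = \<lparr>obj = {X. fuzzy_space X}, hom = top_hom,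
    ident = (\<lambda>X. \<lambda>x\<in>spts X. x),
    compos = (\<lambda>X Y Z g f. compose (spts X) g f)\<rparr>"


section \<open>Graded fuzzy topological systems\<close>

record ('x, 'a) ftopsys =
  ypts :: "'x set"
  ysat :: "'x \<Rightarrow> 'a \<Rightarrow> unit_interval"
  yframe :: "'a gframe"

text \<open>The meet of a finite subset is the iterated binary meet over an enumeration of it, and the
  top element for the empty set.\<close>

definition finite_meet :: "'a gframe \<Rightarrow> 'a list \<Rightarrow> 'a" where
  "finite_meet A as = foldr (fmeet A) as (ftop A)"

text \<open>The set of points may be empty: a graded frame such as the one-element frame has no
  homomorphism into $[0,1]$, so the system of its points is empty, and so is the system of an
  empty space.\<close>

definition graded_fuzzy_topsys :: "('x, 'a) ftopsys \<Rightarrow> bool" where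
  "graded_fuzzy_topsys D \<longleftrightarrow>
    graded_frame (yframe D) \<and>
    (\<forall>x\<in>ypts D. \<forall>a\<in>fcarrier (yframe D). \<forall>b\<in>fcarrier (yframe D).
      min (ysat D x a) (frel (yframe D) a b) \<le> ysat D x b) \<and>
    (\<forall>x\<in>ypts D. \<forall>as. set as \<subseteq> fcarrier (yframe D) \<longrightarrow>
      ysat D x (finite_meet (yframe D) as) = (INF a\<in>set as. ysat D x a)) \<and>
    (\<forall>x\<in>ypts D. \<forall>S. S \<subseteq> fcarrier (yframe D) \<longrightarrow>
      ysat D x (fjoin (yframe D) S) = (SUP a\<in>S. ysat D x a))"

definition sys_hom ::
    "('x, 'a) ftopsys \<Rightarrow> ('y, 'b) ftopsys \<Rightarrow> (('x \<Rightarrow> 'y) \<times> ('b \<Rightarrow> 'a)) set" where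
  "sys_hom D E = {(f\<^sub>1, f\<^sub>2). f\<^sub>1 \<in> ypts D \<rightarrow>\<^sub>E ypts E \<and> f\<^sub>2 \<in> frm_hom (yframe E) (yframe D) \<and>
    (\<forall>x\<in>ypts D. \<forall>b\<in>fcarrier (yframe E). ysat D x (f\<^sub>2 b) = ysat E (f\<^sub>1 x) b)}"

definition Graded_Fuzzy_TopSys ::
    "(('x, 'a) ftopsys, ('x \<Rightarrow> 'x) \<times> ('a \<Rightarrow> 'a)) precategory" where
  "Graded_Fuzzy_TopSys = \<lparr>obj = {D. graded_fuzzy_topsys D}, hom = sys_hom,
    ident = (\<lambda>D. (\<lambda>x\<in>ypts D. x, \<lambda>a\<in>fcarrier (yframe D). a)),
    compos = (\<lambda>D E F g f. (compose (ypts D) (fst g) (fst f),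
      compose (fcarrier (yframe F)) (snd f) (snd g)))\<rparr>"


section \<open>The functors\<close>

definition ext :: "('x, 'a) ftopsys \<Rightarrow> 'a \<Rightarrow> 'x \<Rightarrow> unit_interval" where
  "ext D a = (\<lambda>x\<in>ypts D. ysat D x a)"

definition Ext_g ::
    "(('x, 'a) ftopsys, ('x \<Rightarrow> 'x) \<times> ('a \<Rightarrow> 'a), 'x fspace, 'x \<Rightarrow> 'x) prefunctor" where
  "Ext_g = \<lparr>omap = (\<lambda>D. \<lparr>spts = ypts D, sopens = ext D ` fcarrier (yframe D)\<rparr>),
    amap = (\<lambda>D E f. fst f)\<rparr>"

definition opens_frame :: "'x fspace \<Rightarrow> ('x \<Rightarrow> unit_interval) gframe" where
  "opens_frame X = \<lparr>fcarrier = sopens X, ftop = (\<lambda>x\<in>spts X. top),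
    fmeet = fuzzy_inter (spts X), fjoin = fuzzy_union (spts X), frel = graded_incl (spts X)\<rparr>"

definition J_g ::
    "('x fspace, 'x \<Rightarrow> 'x, ('x, 'x \<Rightarrow> unit_interval) ftopsys,
      ('x \<Rightarrow> 'x) \<times> (('x \<Rightarrow> unit_interval) \<Rightarrow> 'x \<Rightarrow> unit_interval)) prefunctor" where
  "J_g = \<lparr>omap = (\<lambda>X. \<lparr>ypts = spts X, ysat = (\<lambda>x T. T x), yframe = opens_frame X\<rparr>),
    amap = (\<lambda>X Y f. (f, \<lambda>T\<in>sopens Y. compose (spts X) T f))\<rparr>"

definition fm_g ::
    "(('x, 'a) ftopsys, ('x \<Rightarrow> 'x) \<times> ('a \<Rightarrow> 'a), 'a gframe, 'a \<Rightarrow> 'a) prefunctor" where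
  "fm_g = \<lparr>omap = yframe, amap = (\<lambda>D E f. snd f)\<rparr>"

text \<open>The source of \<open>S_g\<close> is the opposite category: an arrow from \<open>A\<close> to \<open>B\<close> is a
  homomorphism from \<open>B\<close> to \<open>A\<close>.\<close>

definition S_g ::
    "('a gframe, 'a \<Rightarrow> 'a, ('a \<Rightarrow> unit_interval, 'a) ftopsys,
      (('a \<Rightarrow> unit_interval) \<Rightarrow> 'a \<Rightarrow> unit_interval) \<times> ('a \<Rightarrow> 'a)) prefunctor" where
  "S_g = \<lparr>omap = (\<lambda>A. \<lparr>ypts = frm_hom A unit_frame, ysat = (\<lambda>v a. v a), yframe = A\<rparr>),
    amap = (\<lambda>A B f. (\<lambda>v\<in>frm_hom A unit_frame. compose (fcarrier B) v f, f))\<rparr>"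


section \<open>Adjunction\<close>

text \<open>Passing from a space to its opens or from a frame to its points raises the type of the
  elements, so the values of either functor lie in the other category at another type.
  Apart from that this is the usual definition by a bijection between $Hom(X, G A)$ and
  $Hom^{op}(F X, A) = Hom(A, F X)$, natural in \<open>X\<close> and \<open>A\<close>; the homs \<open>top_hom\<close> and \<open>frm_hom\<close>
  exist across types. No set of spaces or frames is left out, since
  the types of \<open>x\<close> and \<open>a\<close> are arbitrary.\<close>

definition is_right_adjoint ::
    "('a gframe, 'a \<Rightarrow> 'a, 'y fspace, 'y \<Rightarrow> 'y) prefunctor \<Rightarrow>
      ('x fspace, 'x \<Rightarrow> 'x, 'b gframe, 'b \<Rightarrow> 'b) prefunctor \<Rightarrow> bool" where
  "is_right_adjoint G F \<longleftrightarrow>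
    is_functor (op_cat Graded_Frm) Graded_Fuzzy_Top G \<and>
    is_functor Graded_Fuzzy_Top (op_cat Graded_Frm) F \<and>
    (\<exists>\<Phi> :: 'x fspace \<Rightarrow> 'a gframe \<Rightarrow> ('x \<Rightarrow> 'y) \<Rightarrow> 'a \<Rightarrow> 'b.
      (\<forall>X A. fuzzy_space X \<and> graded_frame A \<longrightarrow>
        bij_betw (\<Phi> X A) (top_hom X (omap G A)) (frm_hom A (omap F X))) \<and>
      (\<forall>X' X A. fuzzy_space X' \<and> fuzzy_space X \<and> graded_frame A \<longrightarrow>
        (\<forall>g\<in>top_hom X' X. \<forall>f\<in>top_hom X (omap G A).
          \<Phi> X' A (compose (spts X') f g) = compose (fcarrier A) (amap F X' X g) (\<Phi> X A f))) \<and>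
      (\<forall>X A B. fuzzy_space X \<and> graded_frame A \<and> graded_frame B \<longrightarrow>
        (\<forall>h\<in>frm_hom B A. \<forall>f\<in>top_hom X (omap G A).
          \<Phi> X B (compose (spts X) (amap G A B h) f) = compose (fcarrier B) (\<Phi> X A f) h)))"

end

theory Submission
  imports Defs
begin

text \<open>
  The adjunction is the exchange of the two arguments of a function of a point \<open>x\<close> and a frame
  element \<open>a\<close>.  A continuous map from a space \<open>X\<close> to the space of points of \<open>A\<close> assigns to each
  \<open>x\<close> a homomorphism $a \mapsto f(x)(a)$ from \<open>A\<close> to $[0,1]$; read the other way, it assigns to
  each \<open>a\<close> the fuzzy set $x \mapsto f(x)(a)$.  This fuzzy set is the preimage under \<open>f\<close> of the
  open set $v \mapsto v(a)$ of points, so continuity of \<open>f\<close> says precisely that it is open for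
  every \<open>a\<close> (\<open>top_hom_points_iff\<close>).  What remains is to know that the resulting map from \<open>A\<close> to
  the opens of \<open>X\<close> is a homomorphism precisely when each $f(x)$ is one.  This holds because the
  operations on open sets are computed pointwise and graded inclusion is the infimum over the
  points of the arrow of $[0,1]$ (\<open>frm_hom_opens_iff\<close>).

  The functors are instances of the same idea.  A graded fuzzy topological system is a family of
  homomorphisms into $[0,1]$ indexed by its points (\<open>graded_fuzzy_topsys_iff\<close>): by residuation,
  the first axiom of systems says that $R(a,b) \le (gr(x\models a) \to gr(x\models b))$.  The
  points of \<open>S_g\<close> are homomorphisms by definition, and those of \<open>J_g\<close> act as evaluations, which are
  homomorphisms on the frame of opens (\<open>frm_hom_eval\<close>).  For \<open>Ext_g\<close>, each point acting as a
  homomorphism makes the extents closed under the operations of a fuzzy topology.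
\<close>

section \<open>The Goedel arrow\<close>

lemma le_godel_arrow_iff: "c \<le> godel_arrow a b \<longleftrightarrow> min a c \<le> b"
  by (auto simp: godel_arrow_def min_def)

lemma godel_arrow_eq_top_iff: "godel_arrow a b = top \<longleftrightarrow> a \<le> b"
  by (auto simp: godel_arrow_def top_unique)

lemma min_Sup_eq: "min a (Sup S) = (SUP b\<in>S. min a b)" for a :: unit_interval
  by (simp add: inf_Sup flip: inf_min)

lemma min_INF_eq: "min (INF i\<in>I. f i) (INF i\<in>I. g i) = (INF i\<in>I. min (f i) (g i))"
  for f g :: "'i \<Rightarrow> unit_interval"
  by (simp add: INF_inf_distrib flip: inf_min)

lemma godel_arrow_min: "godel_arrow a (min b c) = min (godel_arrow a b) (godel_arrow a c)"
  by (rule order_antisym) (auto simp: godel_arrow_def min_def)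

text \<open>By residuation both sides have the same lower bounds, since minima distribute over
  suprema.\<close>

lemma godel_arrow_SUP: "godel_arrow (SUP i\<in>I. f i) b = (INF i\<in>I. godel_arrow (f i) b)"
proof -
  have "c \<le> godel_arrow (SUP i\<in>I. f i) b \<longleftrightarrow> c \<le> (INF i\<in>I. godel_arrow (f i) b)" for c
    by (simp add: le_godel_arrow_iff le_INF_iff min.commute[of _ c] min_Sup_eq SUP_le_iff
        image_image)
  then show ?thesis
    by (meson order_antisym order_refl)
qed


section \<open>Homomorphisms of graded frames\<close>

lemma graded_frameD:
  assumes "graded_frame A"
  shows "ftop A \<in> fcarrier A"
    and "\<forall>a\<in>fcarrier A. \<forall>b\<in>fcarrier A. fmeet A a b \<in> fcarrier A"
    and "\<forall>S. S \<subseteq> fcarrier A \<longrightarrow> fjoin A S \<in> fcarrier A"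
    and "\<forall>a\<in>fcarrier A. frel A a a = top"
    and "\<forall>a\<in>fcarrier A. \<forall>b\<in>fcarrier A. frel A a b = top \<and> frel A b a = top \<longrightarrow> a = b"
    and "\<forall>a\<in>fcarrier A. \<forall>b\<in>fcarrier A.
      frel A (fmeet A a b) a = top \<and> frel A (fmeet A a b) b = top"
    and "\<forall>a\<in>fcarrier A. frel A a (ftop A) = top"
    and "\<forall>a\<in>fcarrier A. \<forall>b\<in>fcarrier A. \<forall>c\<in>fcarrier A.
      min (frel A a b) (frel A a c) = frel A a (fmeet A b c)"
  by (insert assms, unfold graded_frame_def, (elim conjE, assumption)+)

lemma graded_frame_closed:
  assumes "graded_frame A"
  shows "ftop A \<in> fcarrier A"
    and "a \<in> fcarrier A \<Longrightarrow> b \<in> fcarrier A \<Longrightarrow> fmeet A a b \<in> fcarrier A"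
    and "S \<subseteq> fcarrier A \<Longrightarrow> fjoin A S \<in> fcarrier A"
  using graded_frameD(1-3)[OF assms] by blast+

text \<open>The equation holds because $R(b, b \wedge \top) = R(b,b) \wedge R(b,\top) = 1$.  It
  makes the list \<open>[a, b]\<close> have meet $a \wedge b$.\<close>

lemma fmeet_ftop:
  assumes A: "graded_frame A" and b: "b \<in> fcarrier A"
  shows "fmeet A b (ftop A) = b"
proof -
  note D = graded_frameD[OF A]
  have m: "fmeet A b (ftop A) \<in> fcarrier A"
    using D(1,2) b by blast
  have "frel A b (fmeet A b (ftop A)) = min (frel A b b) (frel A b (ftop A))"
    using D(8)[rule_format, OF b b D(1)] by (rule sym)
  also have "\<dots> = top"
    using D(4,7) b by simp
  finally have "frel A b (fmeet A b (ftop A)) = top" .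
  moreover have "frel A (fmeet A b (ftop A)) b = top"
    using D(6)[rule_format, OF b D(1)] by (rule conjunct1)
  ultimately show ?thesis
    using D(5) m b by blast
qed

lemma frm_homI:
  assumes "f \<in> fcarrier A \<rightarrow>\<^sub>E fcarrier B"
    and "f (ftop A) = ftop B"
    and "\<And>a b. a \<in> fcarrier A \<Longrightarrow> b \<in> fcarrier A \<Longrightarrow> f (fmeet A a b) = fmeet B (f a) (f b)"
    and "\<And>S. S \<subseteq> fcarrier A \<Longrightarrow> f (fjoin A S) = fjoin B (f ` S)"
    and "\<And>a b. a \<in> fcarrier A \<Longrightarrow> b \<in> fcarrier A \<Longrightarrow> frel A a b \<le> frel B (f a) (f b)"
  shows "f \<in> frm_hom A B"
  using assms unfolding frm_hom_def by blast

lemma frm_homD: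
  assumes "f \<in> frm_hom A B"
  shows "f \<in> fcarrier A \<rightarrow>\<^sub>E fcarrier B"
    and "a \<in> fcarrier A \<Longrightarrow> f a \<in> fcarrier B"
    and "f (ftop A) = ftop B"
    and "a \<in> fcarrier A \<Longrightarrow> b \<in> fcarrier A \<Longrightarrow> f (fmeet A a b) = fmeet B (f a) (f b)"
    and "S \<subseteq> fcarrier A \<Longrightarrow> f (fjoin A S) = fjoin B (f ` S)"
    and "a \<in> fcarrier A \<Longrightarrow> b \<in> fcarrier A \<Longrightarrow> frel A a b \<le> frel B (f a) (f b)"
  using assms unfolding frm_hom_def by auto

lemma frm_hom_unit_iff:
  "v \<in> frm_hom A unit_frame \<longleftrightarrow> v \<in> extensional (fcarrier A) \<and> v (ftop A) = top \<and>
    (\<forall>a\<in>fcarrier A. \<forall>b\<in>fcarrier A. v (fmeet A a b) = min (v a) (v b)) \<and>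
    (\<forall>S. S \<subseteq> fcarrier A \<longrightarrow> v (fjoin A S) = Sup (v ` S)) \<and>
    (\<forall>a\<in>fcarrier A. \<forall>b\<in>fcarrier A. frel A a b \<le> godel_arrow (v a) (v b))"
  by (auto simp: frm_hom_def unit_frame_def PiE_def)

lemma restrict_image_subset: "S \<subseteq> A \<Longrightarrow> restrict f A ` S = f ` S"
  by (rule image_cong) auto

lemma frm_hom_unit_restrict_iff:
  assumes A: "graded_frame A"
  shows "(\<lambda>a\<in>fcarrier A. s a) \<in> frm_hom A unit_frame \<longleftrightarrow> s (ftop A) = top \<and>
    (\<forall>a\<in>fcarrier A. \<forall>b\<in>fcarrier A. s (fmeet A a b) = min (s a) (s b)) \<and>
    (\<forall>S. S \<subseteq> fcarrier A \<longrightarrow> s (fjoin A S) = (SUP a\<in>S. s a)) \<and>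
    (\<forall>a\<in>fcarrier A. \<forall>b\<in>fcarrier A. frel A a b \<le> godel_arrow (s a) (s b))"
  unfolding frm_hom_unit_iff
  (* The congruence rule for images would split the restriction into cases before
     restrict_image_subset can remove it. *)
  by (simp add: graded_frame_closed[OF A] restrict_image_subset
      cong: ball_cong cong del: image_cong_simp)

lemma frm_hom_compose:
  assumes A: "graded_frame A" and f: "f \<in> frm_hom A B" and g: "g \<in> frm_hom B C"
  shows "compose (fcarrier A) g f \<in> frm_hom A C"
proof -
  note closed = graded_frame_closed[OF A] and fD = frm_homD[OF f] and gD = frm_homD[OF g]
  show ?thesis
  proof (rule frm_homI)
    show "compose (fcarrier A) g f \<in> fcarrier A \<rightarrow>\<^sub>E fcarrier C"
      using fD(2) gD(2) by (auto simp: compose_def)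
    show "compose (fcarrier A) g f (ftop A) = ftop C"
      by (simp add: compose_eq closed(1) fD(3) gD(3))
  next
    fix a b assume ab: "a \<in> fcarrier A" "b \<in> fcarrier A"
    then show "compose (fcarrier A) g f (fmeet A a b) =
        fmeet C (compose (fcarrier A) g f a) (compose (fcarrier A) g f b)"
      by (simp add: compose_eq closed(2) fD(2,4) gD(4))
    have "frel A a b \<le> frel C (g (f a)) (g (f b))"
      using order_trans[OF fD(6)[OF ab] gD(6)[OF fD(2) fD(2), OF ab]] .
    with ab show "frel A a b \<le> frel C (compose (fcarrier A) g f a) (compose (fcarrier A) g f b)"
      by (simp add: compose_eq)
  next
    fix S assume S: "S \<subseteq> fcarrier A"
    have "f ` S \<subseteq> fcarrier B"
      using S fD(2) by auto
    moreover have "compose (fcarrier A) g f ` S = g ` f ` S"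
      unfolding compose_def restrict_image_subset[OF S] by (rule image_image[symmetric])
    ultimately show "compose (fcarrier A) g f (fjoin A S) = fjoin C (compose (fcarrier A) g f ` S)"
      using S by (simp add: compose_eq closed(3) fD(5) gD(5))
  qed
qed

lemma frm_hom_ident:
  assumes "graded_frame A"
  shows "(\<lambda>a\<in>fcarrier A. a) \<in> frm_hom A A"
proof -
  have "(\<lambda>a\<in>fcarrier A. a) ` S = S" if "S \<subseteq> fcarrier A" for S
    unfolding restrict_image_subset[OF that] by simp
  then show ?thesis
    by (intro frm_homI) (simp_all add: graded_frame_closed[OF assms])
qed


section \<open>The frame of open sets\<close>

lemma opens_frame_simps [simp]:
  "fcarrier (opens_frame X) = sopens X" "ftop (opens_frame X) = (\<lambda>x\<in>spts X. top)"
  "fmeet (opens_frame X) = fuzzy_inter (spts X)" "fjoin (opens_frame X) = fuzzy_union (spts X)"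
  "frel (opens_frame X) = graded_incl (spts X)"
  by (simp_all add: opens_frame_def)

lemma fuzzy_inter_apply: "x \<in> X \<Longrightarrow> fuzzy_inter X T U x = min (T x) (U x)"
  by (simp add: fuzzy_inter_def)

lemma fuzzy_union_apply: "x \<in> X \<Longrightarrow> fuzzy_union X \<T> x = (SUP T\<in>\<T>. T x)"
  by (simp add: fuzzy_union_def)

lemma fuzzy_spaceD:
  assumes "fuzzy_space X"
  shows "T \<in> sopens X \<Longrightarrow> T \<in> extensional (spts X)"
    and "(\<lambda>x\<in>spts X. top) \<in> sopens X"
    and "\<T> \<subseteq> sopens X \<Longrightarrow> fuzzy_union (spts X) \<T> \<in> sopens X"
    and "T \<in> sopens X \<Longrightarrow> U \<in> sopens X \<Longrightarrow> fuzzy_inter (spts X) T U \<in> sopens X"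
  using assms unfolding fuzzy_space_def by (auto simp: PiE_def)

lemma graded_incl_eq_top_iff: "graded_incl X T U = top \<longleftrightarrow> (\<forall>x\<in>X. T x \<le> U x)"
  unfolding graded_incl_def
  by (simp add: INF_top_conv godel_arrow_eq_top_iff)

text \<open>The axioms follow pointwise from the corresponding properties of the Goedel arrow; frame
  distributivity is that of a complete chain.\<close>

lemma graded_frame_opens:
  assumes X: "fuzzy_space X"
  shows "graded_frame (opens_frame X)"
proof -
  note XD = fuzzy_spaceD[OF X]
  have "T = U" if "T \<in> sopens X" "U \<in> sopens X" "\<forall>x\<in>spts X. T x \<le> U x" "\<forall>x\<in>spts X. U x \<le> T x"
    for T U
    by (rule extensionalityI[of _ "spts X"]) (use that XD(1) in \<open>auto intro: order_antisym\<close>)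
  moreover have "min (graded_incl (spts X) T U) (graded_incl (spts X) U V)
      \<le> graded_incl (spts X) T V" for T U V
  proof -
    have "min (graded_incl (spts X) T U) (graded_incl (spts X) U V) \<le> godel_arrow (T x) (V x)"
      if x: "x \<in> spts X" for x
    proof -
      have "graded_incl (spts X) T U \<le> godel_arrow (T x) (U x)"
        "graded_incl (spts X) U V \<le> godel_arrow (U x) (V x)"
        unfolding graded_incl_def using x by (auto intro: INF_lower)
      then show ?thesis
        unfolding le_godel_arrow_iff by (auto simp: min_def split: if_splits)
    qed
    then show ?thesis
      unfolding graded_incl_def[of _ T V] by (rule INF_greatest)
  qed
  moreover have "min (graded_incl (spts X) T U) (graded_incl (spts X) T V)
      = graded_incl (spts X) T (fuzzy_inter (spts X) U V)" for T U V
    by (simp add: graded_incl_def fuzzy_inter_def godel_arrow_min min_INF_eq)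
  moreover have "(INF T\<in>\<T>. graded_incl (spts X) T U)
      = graded_incl (spts X) (fuzzy_union (spts X) \<T>) U" for \<T> U
    unfolding graded_incl_def fuzzy_union_def
    by (subst INF_commute) (simp add: godel_arrow_SUP)
  moreover have "fuzzy_inter (spts X) T (fuzzy_union (spts X) \<T>) x
      \<le> fuzzy_union (spts X) (fuzzy_inter (spts X) T ` \<T>) x" if "x \<in> spts X" for T \<T> x
    using that by (simp add: fuzzy_inter_def fuzzy_union_def min_Sup_eq image_image)
  ultimately show ?thesis
    unfolding graded_frame_def opens_frame_simps
    by (auto simp: XD graded_incl_eq_top_iff fuzzy_inter_apply fuzzy_union_apply
        intro: SUP_upper)
qed

text \<open>Open sets are equal if they agree at every point, the operations on them are computed
  pointwise, and a lower bound of the graded inclusion is a common lower bound of the arrows at the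
  points.  So every condition on a homomorphism can be tested at the points.\<close>

lemma frm_hom_opens_iff:
  assumes A: "graded_frame A" and X: "fuzzy_space X"
  shows "g \<in> frm_hom A (opens_frame X) \<longleftrightarrow> g \<in> fcarrier A \<rightarrow>\<^sub>E sopens X \<and>
    (\<forall>x\<in>spts X. (\<lambda>a\<in>fcarrier A. g a x) \<in> frm_hom A unit_frame)"
proof (cases "g \<in> fcarrier A \<rightarrow>\<^sub>E sopens X")
  case True
  note closed = graded_frame_closed[OF A]
  have ext: "g a \<in> extensional (spts X)" if "a \<in> fcarrier A" for a
    using True that fuzzy_spaceD(1)[OF X] by auto
  have pw: "g a = T \<longleftrightarrow> (\<forall>x\<in>spts X. g a x = T x)"
    if "a \<in> fcarrier A" "T \<in> extensional (spts X)" for a T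
    using that ext extensionalityI by metis
  have top_iff: "g (ftop A) = (\<lambda>x\<in>spts X. top) \<longleftrightarrow> (\<forall>x\<in>spts X. g (ftop A) x = top)"
    by (subst pw) (auto simp: closed)
  have meet_iff: "g (fmeet A a b) = fuzzy_inter (spts X) (g a) (g b) \<longleftrightarrow>
      (\<forall>x\<in>spts X. g (fmeet A a b) x = min (g a x) (g b x))"
    if "a \<in> fcarrier A" "b \<in> fcarrier A" for a b
    using that by (subst pw) (auto simp: closed fuzzy_inter_def)
  have join_iff: "g (fjoin A S) = fuzzy_union (spts X) (g ` S) \<longleftrightarrow>
      (\<forall>x\<in>spts X. g (fjoin A S) x = (SUP a\<in>S. g a x))"
    if "S \<subseteq> fcarrier A" for S
    using that by (subst pw) (auto simp: closed fuzzy_union_def image_image)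
  have rel_iff: "frel A a b \<le> graded_incl (spts X) (g a) (g b) \<longleftrightarrow>
      (\<forall>x\<in>spts X. frel A a b \<le> godel_arrow (g a x) (g b x))" for a b
    by (simp add: graded_incl_def le_INF_iff)
  have hom_iff: "g \<in> frm_hom A (opens_frame X) \<longleftrightarrow>
      (\<forall>x\<in>spts X. g (ftop A) x = top) \<and>
      (\<forall>a\<in>fcarrier A. \<forall>b\<in>fcarrier A. \<forall>x\<in>spts X. g (fmeet A a b) x = min (g a x) (g b x)) \<and>
      (\<forall>S. S \<subseteq> fcarrier A \<longrightarrow> (\<forall>x\<in>spts X. g (fjoin A S) x = (SUP a\<in>S. g a x))) \<and>
      (\<forall>a\<in>fcarrier A. \<forall>b\<in>fcarrier A. \<forall>x\<in>spts X.
        frel A a b \<le> godel_arrow (g a x) (g b x))"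
    using True by (simp add: frm_hom_def top_iff meet_iff join_iff rel_iff cong: ball_cong)
  have eval_iff: "(\<lambda>a\<in>fcarrier A. g a x) \<in> frm_hom A unit_frame \<longleftrightarrow>
      g (ftop A) x = top \<and>
      (\<forall>a\<in>fcarrier A. \<forall>b\<in>fcarrier A. g (fmeet A a b) x = min (g a x) (g b x)) \<and>
      (\<forall>S. S \<subseteq> fcarrier A \<longrightarrow> g (fjoin A S) x = (SUP a\<in>S. g a x)) \<and>
      (\<forall>a\<in>fcarrier A. \<forall>b\<in>fcarrier A. frel A a b \<le> godel_arrow (g a x) (g b x))" for x
    by (rule frm_hom_unit_restrict_iff[OF A])
  have "g \<in> frm_hom A (opens_frame X) \<longleftrightarrow>
      (\<forall>x\<in>spts X. (\<lambda>a\<in>fcarrier A. g a x) \<in> frm_hom A unit_frame)"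
    \<comment> \<open>Both sides are now conjunctions of four conditions that correspond in order and differ only
      in the place of the quantifier over the points.\<close>
    unfolding hom_iff eval_iff ball_conj_distrib
    by (intro arg_cong2[where f = "(\<and>)"]; blast)
  with True show ?thesis
    by simp
qed (simp add: frm_hom_def)

text \<open>This is the pointwise criterion applied to the identity homomorphism.\<close>

lemma frm_hom_eval:
  assumes X: "fuzzy_space X" and x: "x \<in> spts X"
  shows "(\<lambda>T\<in>sopens X. T x) \<in> frm_hom (opens_frame X) unit_frame"
proof -
  have "(\<lambda>T\<in>sopens X. T) \<in> frm_hom (opens_frame X) (opens_frame X)"
    using frm_hom_ident[OF graded_frame_opens[OF X]] by simp
  then have "(\<lambda>T\<in>sopens X. (\<lambda>T\<in>sopens X. T) T x) \<in> frm_hom (opens_frame X) unit_frame"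
    using x unfolding frm_hom_opens_iff[OF graded_frame_opens[OF X] X] by simp
  then show ?thesis
    by (simp cong: restrict_cong)
qed

text \<open>Evaluating the preimage of an open set at \<open>x\<close> is evaluating the set at \<open>f x\<close>.\<close>

lemma frm_hom_preimage:
  assumes X: "fuzzy_space X" and Y: "fuzzy_space Y" and f: "f \<in> top_hom X Y"
  shows "(\<lambda>T\<in>sopens Y. compose (spts X) T f) \<in> frm_hom (opens_frame Y) (opens_frame X)"
proof -
  have fx: "f x \<in> spts Y" if "x \<in> spts X" for x
    using f that by (auto simp: top_hom_def)
  have "(\<lambda>T\<in>sopens Y. (\<lambda>T\<in>sopens Y. compose (spts X) T f) T x) = (\<lambda>T\<in>sopens Y. T (f x))"
    if "x \<in> spts X" for x
    using that by (auto simp: compose_def)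
  then show ?thesis
    using f fx frm_hom_eval[OF Y]
    unfolding frm_hom_opens_iff[OF graded_frame_opens[OF Y] X]
    by (auto simp: top_hom_def)
qed


section \<open>Systems as families of homomorphisms\<close>

text \<open>By residuation the first axiom of systems says that satisfaction at \<open>x\<close> carries $R$ below the
  Goedel arrow; the axiom on finite meets amounts to the cases of the empty and the binary
  meet.\<close>

lemma graded_fuzzy_topsys_iff:
  "graded_fuzzy_topsys D \<longleftrightarrow> graded_frame (yframe D) \<and>
    (\<forall>x\<in>ypts D. (\<lambda>a\<in>fcarrier (yframe D). ysat D x a) \<in> frm_hom (yframe D) unit_frame)"
proof (cases "graded_frame (yframe D)")
  case True
  define A where "A = yframe D"
  have A: "graded_frame A"
    using True by (simp add: A_def)
  note closed = graded_frame_closed[OF A]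
  have point: "(\<forall>a\<in>fcarrier A. \<forall>b\<in>fcarrier A. min (s a) (frel A a b) \<le> s b) \<and>
      (\<forall>as. set as \<subseteq> fcarrier A \<longrightarrow> s (finite_meet A as) = (INF a\<in>set as. s a)) \<and>
      (\<forall>S. S \<subseteq> fcarrier A \<longrightarrow> s (fjoin A S) = (SUP a\<in>S. s a)) \<longleftrightarrow>
      (\<lambda>a\<in>fcarrier A. s a) \<in> frm_hom A unit_frame" (is "?rel \<and> ?meet \<and> ?join \<longleftrightarrow> _") for s
  proof -
    have "?meet \<longleftrightarrow> s (ftop A) = top \<and>
        (\<forall>a\<in>fcarrier A. \<forall>b\<in>fcarrier A. s (fmeet A a b) = min (s a) (s b))"
      (is "_ \<longleftrightarrow> _ \<and> ?bin")
    proof (intro iffI conjI ballI)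
      assume meet: ?meet
      show "s (ftop A) = top"
        using meet[rule_format, of "[]"] by (simp add: finite_meet_def)
      fix a b assume "a \<in> fcarrier A" "b \<in> fcarrier A"
      then show "s (fmeet A a b) = min (s a) (s b)"
        using meet[rule_format, of "[a, b]"] by (simp add: finite_meet_def fmeet_ftop A inf_min)
    next
      assume top_bin: "s (ftop A) = top \<and> ?bin"
      have "finite_meet A as \<in> fcarrier A \<and> s (finite_meet A as) = (INF a\<in>set as. s a)"
        if "set as \<subseteq> fcarrier A" for as
        using that
        by (induction as) (auto simp: finite_meet_def closed top_bin inf_min)
      then show ?meet by blast
    qed
    then show ?thesis
      unfolding frm_hom_unit_restrict_iff[OF A] le_godel_arrow_iff by blast
  qed
  show ?thesis
    unfolding graded_fuzzy_topsys_def A_def[symmetric] ball_conj_distrib[symmetric] point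
    by (rule refl)
qed (simp add: graded_fuzzy_topsys_def)

lemma sys_homD:
  assumes "f \<in> sys_hom D E"
  shows "fst f \<in> ypts D \<rightarrow>\<^sub>E ypts E"
    and "x \<in> ypts D \<Longrightarrow> fst f x \<in> ypts E"
    and "snd f \<in> frm_hom (yframe E) (yframe D)"
    and "x \<in> ypts D \<Longrightarrow> b \<in> fcarrier (yframe E) \<Longrightarrow> ysat D x (snd f b) = ysat E (fst f x) b"
  using assms unfolding sys_hom_def by auto


section \<open>The categories\<close>

lemma is_category_op: "is_category C \<Longrightarrow> is_category (op_cat C)"
  unfolding is_category_def op_cat_def by simp

lemma compose_restrict_id:
  assumes "f \<in> A \<rightarrow>\<^sub>E B"
  shows "compose A f (\<lambda>a\<in>A. a) = f" "compose A (\<lambda>b\<in>B. b) f = f"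
  using assms by (auto simp: compose_def fun_eq_iff PiE_def extensional_def Pi_def)

lemma is_category_Graded_Frm: "is_category Graded_Frm"
  unfolding is_category_def Graded_Frm_def
  by (auto simp: frm_hom_ident frm_hom_compose compose_restrict_id[OF frm_homD(1)]
      intro: compose_assoc[symmetric] dest: frm_homD(1))

lemma top_homD:
  assumes "f \<in> top_hom X Y"
  shows "f \<in> spts X \<rightarrow>\<^sub>E spts Y"
    and "x \<in> spts X \<Longrightarrow> f x \<in> spts Y"
    and "T \<in> sopens Y \<Longrightarrow> compose (spts X) T f \<in> sopens X"
  using assms unfolding top_hom_def by auto

lemma top_hom_compose:
  fixes Z :: "'c fspace"
  assumes f: "f \<in> top_hom X Y" and g: "g \<in> top_hom Y Z"
  shows "compose (spts X) g f \<in> top_hom X Z"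
proof -
  have "compose (spts X) T (compose (spts X) g f) = compose (spts X) (compose (spts Y) T g) f"
    for T :: "'c \<Rightarrow> unit_interval"
    using top_homD(2)[OF f] by (intro compose_assoc) auto
  moreover have "compose (spts X) g f \<in> spts X \<rightarrow>\<^sub>E spts Z"
    using top_homD(2)[OF f] top_homD(2)[OF g] by (auto simp: compose_def)
  ultimately show ?thesis
    using top_homD(3)[OF f] top_homD(3)[OF g] by (simp add: top_hom_def)
qed

lemma top_hom_ident:
  assumes "fuzzy_space X"
  shows "(\<lambda>x\<in>spts X. x) \<in> top_hom X X"
proof -
  have "compose (spts X) T (\<lambda>x\<in>spts X. x) = T" if "T \<in> sopens X" for T
    using fuzzy_spaceD(1)[OF assms that] by (auto simp: compose_def extensional_def)
  then show ?thesis
    by (auto simp: top_hom_def)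
qed

lemma is_category_Graded_Fuzzy_Top: "is_category Graded_Fuzzy_Top"
  unfolding is_category_def Graded_Fuzzy_Top_def
  by (auto simp: top_hom_ident top_hom_compose compose_restrict_id[OF top_homD(1)]
      intro: compose_assoc[symmetric] dest: top_homD(1))

lemma sys_hom_compose:
  assumes F: "graded_frame (yframe F)" and f: "f \<in> sys_hom D E" and g: "g \<in> sys_hom E F"
  shows "(compose (ypts D) (fst g) (fst f), compose (fcarrier (yframe F)) (snd f) (snd g))
    \<in> sys_hom D F"
  using sys_homD[OF f] sys_homD[OF g] frm_homD(2)[OF sys_homD(3)[OF g]]
  by (auto simp: sys_hom_def compose_def[of "ypts D"] frm_hom_compose[OF F] compose_eq)

lemma is_category_Graded_Fuzzy_TopSys: "is_category Graded_Fuzzy_TopSys"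
proof -
  have frame: "graded_frame (yframe D)" if "graded_fuzzy_topsys D" for D
    using that by (simp add: graded_fuzzy_topsys_def)
  have fst_snd: "compose (ypts D) (compose (ypts E) (fst h) (fst g)) (fst f)
        = compose (ypts D) (fst h) (compose (ypts D) (fst g) (fst f))"
      "compose (fcarrier (yframe G)) (snd f) (compose (fcarrier (yframe G)) (snd g) (snd h))
        = compose (fcarrier (yframe G)) (compose (fcarrier (yframe F)) (snd f) (snd g)) (snd h)"
    if "f \<in> sys_hom D E" "g \<in> sys_hom E F" "h \<in> sys_hom F G" for D E F G f g h
    using sys_homD(2)[OF that(1)] frm_homD(2)[OF sys_homD(3)[OF that(3)]]
    by (auto intro!: compose_assoc compose_assoc[symmetric])
  show ?thesis
    unfolding is_category_def Graded_Fuzzy_TopSys_def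
    by (auto simp: sys_hom_compose frame fst_snd compose_restrict_id[OF sys_homD(1)]
        compose_restrict_id[OF frm_homD(1)[OF sys_homD(3)]])
      (auto simp: sys_hom_def frm_hom_ident frame)
qed


section \<open>The functors\<close>

lemma is_functor_comp:
  assumes "is_functor C D F" "is_functor D E G"
  shows "is_functor C E (G \<circ>\<^sub>F F)"
  using assms unfolding is_functor_def functor_comp_def by simp

lemma topsys_points:
  assumes "graded_frame A"
  shows "graded_fuzzy_topsys \<lparr>ypts = frm_hom A unit_frame, ysat = (\<lambda>v a. v a), yframe = A\<rparr>"
proof -
  have "(\<lambda>a\<in>fcarrier A. v a) = v" if "v \<in> frm_hom A unit_frame" for v
    using frm_homD(1)[OF that] by (auto simp: PiE_def extensional_restrict)
  with assms show ?thesis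
    by (auto simp: graded_fuzzy_topsys_iff)
qed

lemma is_functor_S_g: "is_functor (op_cat Graded_Frm) Graded_Fuzzy_TopSys S_g"
  unfolding is_functor_def
proof (intro conjI ballI)
  show "is_category (op_cat Graded_Frm)" "is_category Graded_Fuzzy_TopSys"
    by (simp_all add: is_category_op is_category_Graded_Frm is_category_Graded_Fuzzy_TopSys)
next
  fix A :: "'a gframe" assume "A \<in> obj (op_cat Graded_Frm)"
  then show "omap S_g A \<in> obj Graded_Fuzzy_TopSys"
    by (simp add: op_cat_def Graded_Frm_def Graded_Fuzzy_TopSys_def S_g_def topsys_points)
next
  fix A B :: "'a gframe" and f
  assume "A \<in> obj (op_cat Graded_Frm)" "B \<in> obj (op_cat Graded_Frm)"
    "f \<in> hom (op_cat Graded_Frm) A B"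
  then have "graded_frame B" and f: "f \<in> frm_hom B A"
    by (simp_all add: op_cat_def Graded_Frm_def)
  then show "amap S_g A B f \<in> hom Graded_Fuzzy_TopSys (omap S_g A) (omap S_g B)"
    by (auto simp: Graded_Fuzzy_TopSys_def S_g_def sys_hom_def frm_hom_compose compose_eq)
next
  fix A :: "'a gframe" assume "A \<in> obj (op_cat Graded_Frm)"
  have "compose (fcarrier A) v (\<lambda>a\<in>fcarrier A. a) = v" if "v \<in> frm_hom A unit_frame" for v
    using frm_homD(1)[OF that] by (rule compose_restrict_id)
  then show "amap S_g A A (ident (op_cat Graded_Frm) A) = ident Graded_Fuzzy_TopSys (omap S_g A)"
    by (auto simp: op_cat_def Graded_Frm_def Graded_Fuzzy_TopSys_def S_g_def cong: restrict_cong)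
next
  fix A B C :: "'a gframe" and f g
  assume "A \<in> obj (op_cat Graded_Frm)" "B \<in> obj (op_cat Graded_Frm)"
    "C \<in> obj (op_cat Graded_Frm)"
    "f \<in> hom (op_cat Graded_Frm) A B" "g \<in> hom (op_cat Graded_Frm) B C"
  then have B: "graded_frame B" and f: "f \<in> frm_hom B A" and g: "g \<in> frm_hom C B"
    by (simp_all add: op_cat_def Graded_Frm_def)
  have "compose (fcarrier C) v (compose (fcarrier C) f g)
      = compose (fcarrier C) (compose (fcarrier B) v f) g" for v :: "'a \<Rightarrow> unit_interval"
    using frm_homD(2)[OF g] by (intro compose_assoc) auto
  then show "amap S_g A C (compos (op_cat Graded_Frm) A B C g f) =
      compos Graded_Fuzzy_TopSys (omap S_g A) (omap S_g B) (omap S_g C)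
        (amap S_g B C g) (amap S_g A B f)"
    using frm_hom_compose[OF B f, of _ unit_frame]
    by (auto simp: op_cat_def Graded_Frm_def Graded_Fuzzy_TopSys_def S_g_def
        compose_def[of "frm_hom A unit_frame"])
qed

text \<open>Since every point acts as a homomorphism, extents are closed under the operations of a
  topology: the constants 1 and 0 are the extents of the top element and of the empty join, and
  intersections and unions of extents are the extents of meets and joins.\<close>

lemma fuzzy_space_Ext_g:
  assumes D: "graded_fuzzy_topsys D"
  shows "fuzzy_space (omap Ext_g D)"
proof -
  define A where "A = yframe D"
  have A: "graded_frame A"
    and hom: "\<And>x. x \<in> ypts D \<Longrightarrow> (\<lambda>a\<in>fcarrier A. ysat D x a) \<in> frm_hom A unit_frame"
    using D by (auto simp: graded_fuzzy_topsys_iff A_def)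
  note closed = graded_frame_closed[OF A]
  have top: "(\<lambda>x\<in>ypts D. top) = ext D (ftop A)"
    using hom by (auto simp: ext_def frm_hom_unit_iff closed)
  have union: "fuzzy_union (ypts D) (ext D ` S) = ext D (fjoin A S)" if S: "S \<subseteq> fcarrier A" for S
  proof -
    have "(SUP a\<in>S. ysat D x a) = ysat D x (fjoin A S)" if "x \<in> ypts D" for x
      using D S that by (simp add: graded_fuzzy_topsys_def A_def)
    then show ?thesis
      by (auto simp: ext_def fuzzy_union_def image_image)
  qed
  have inter: "fuzzy_inter (ypts D) (ext D a) (ext D b) = ext D (fmeet A a b)"
    if "a \<in> fcarrier A" "b \<in> fcarrier A" for a b
    using hom that by (auto simp: ext_def fuzzy_inter_def frm_hom_unit_iff closed)
  have bot: "(\<lambda>x\<in>ypts D. bot) = ext D (fjoin A {})"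
    using union[of "{}"] by (simp add: fuzzy_union_def)
  have "ext D ` fcarrier A \<subseteq> ypts D \<rightarrow>\<^sub>E UNIV"
    by (auto simp: ext_def)
  moreover have "fuzzy_union (ypts D) \<T> \<in> ext D ` fcarrier A"
    if T: "\<T> \<subseteq> ext D ` fcarrier A" for \<T>
  proof -
    obtain S where "S \<subseteq> fcarrier A" "\<T> = ext D ` S"
      using T by (auto simp: subset_image_iff)
    then show ?thesis
      by (simp add: union closed)
  qed
  ultimately show ?thesis
    unfolding fuzzy_space_def Ext_g_def A_def[symmetric]
    by (auto simp: top bot inter closed A_def[symmetric])
qed

lemma Ext_g_simps:
  "spts (omap Ext_g D) = ypts D" "sopens (omap Ext_g D) = ext D ` fcarrier (yframe D)"
  "amap Ext_g D E f = fst f"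
  by (simp_all add: Ext_g_def)

lemma is_functor_Ext_g: "is_functor Graded_Fuzzy_TopSys Graded_Fuzzy_Top
    (Ext_g :: (('x, 'a) ftopsys, _, 'x fspace, _) prefunctor)"
proof -
  have "fst f \<in> top_hom (omap Ext_g D) (omap Ext_g E)"
    if f: "f \<in> sys_hom D E" for D E :: "('x, 'a) ftopsys" and f
  proof -
    \<comment> \<open>The preimage of the extent of \<open>b\<close> is the extent of the image of \<open>b\<close>.\<close>
    have "compose (ypts D) (ext E b) (fst f) = ext D (snd f b)" if "b \<in> fcarrier (yframe E)" for b
      using that sys_homD[OF f] by (auto simp: compose_def ext_def)
    then show ?thesis
      using sys_homD(1)[OF f] frm_homD(2)[OF sys_homD(3)[OF f]]
      by (auto simp: top_hom_def Ext_g_simps)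
  qed
  then show ?thesis
    unfolding is_functor_def
    by (intro conjI is_category_Graded_Fuzzy_TopSys is_category_Graded_Fuzzy_Top)
      (simp_all add: Graded_Fuzzy_TopSys_def Graded_Fuzzy_Top_def fuzzy_space_Ext_g Ext_g_simps)
qed

lemma is_functor_J_g: "is_functor Graded_Fuzzy_Top Graded_Fuzzy_TopSys J_g"
  unfolding is_functor_def
proof (intro conjI ballI)
  show "is_category Graded_Fuzzy_Top" "is_category Graded_Fuzzy_TopSys"
    by (simp_all add: is_category_Graded_Fuzzy_Top is_category_Graded_Fuzzy_TopSys)
next
  fix X :: "'x fspace" assume "X \<in> obj Graded_Fuzzy_Top"
  then show "omap J_g X \<in> obj Graded_Fuzzy_TopSys"
    by (simp add: Graded_Fuzzy_Top_def Graded_Fuzzy_TopSys_def J_g_def graded_fuzzy_topsys_iff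
        graded_frame_opens frm_hom_eval)
next
  fix X Y :: "'x fspace" and f
  assume "X \<in> obj Graded_Fuzzy_Top" "Y \<in> obj Graded_Fuzzy_Top" "f \<in> hom Graded_Fuzzy_Top X Y"
  then have "fuzzy_space X" "fuzzy_space Y" and f: "f \<in> top_hom X Y"
    by (simp_all add: Graded_Fuzzy_Top_def)
  then show "amap J_g X Y f \<in> hom Graded_Fuzzy_TopSys (omap J_g X) (omap J_g Y)"
    using top_homD[OF f]
    by (auto simp: Graded_Fuzzy_TopSys_def J_g_def sys_hom_def frm_hom_preimage compose_eq)
next
  fix X :: "'x fspace" assume "X \<in> obj Graded_Fuzzy_Top"
  then have "compose (spts X) T (\<lambda>x\<in>spts X. x) = T" if "T \<in> sopens X" for T
    using that fuzzy_spaceD(1)[of X T]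
    by (auto simp: Graded_Fuzzy_Top_def compose_def extensional_def)
  then show "amap J_g X X (ident Graded_Fuzzy_Top X) = ident Graded_Fuzzy_TopSys (omap J_g X)"
    by (auto simp: Graded_Fuzzy_Top_def Graded_Fuzzy_TopSys_def J_g_def)
next
  fix X Y Z :: "'x fspace" and f g
  assume "X \<in> obj Graded_Fuzzy_Top" "Y \<in> obj Graded_Fuzzy_Top" "Z \<in> obj Graded_Fuzzy_Top"
    "f \<in> hom Graded_Fuzzy_Top X Y" "g \<in> hom Graded_Fuzzy_Top Y Z"
  then have f: "f \<in> top_hom X Y" and g: "g \<in> top_hom Y Z"
    by (simp_all add: Graded_Fuzzy_Top_def)
  have "compose (spts X) T (compose (spts X) g f) = compose (spts X) (compose (spts Y) T g) f"
    for T :: "'x \<Rightarrow> unit_interval"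
    using top_homD(2)[OF f] by (intro compose_assoc) auto
  then show "amap J_g X Z (compos Graded_Fuzzy_Top X Y Z g f) =
      compos Graded_Fuzzy_TopSys (omap J_g X) (omap J_g Y) (omap J_g Z)
        (amap J_g Y Z g) (amap J_g X Y f)"
    using top_homD(3)[OF g]
    by (auto simp: Graded_Fuzzy_Top_def Graded_Fuzzy_TopSys_def J_g_def compose_def[of "sopens Z"])
qed

lemma is_functor_fm_g: "is_functor Graded_Fuzzy_TopSys (op_cat Graded_Frm) fm_g"
  unfolding is_functor_def
  by (auto simp: is_category_Graded_Fuzzy_TopSys is_category_op is_category_Graded_Frm)
    (auto simp: Graded_Fuzzy_TopSys_def op_cat_def Graded_Frm_def fm_g_def
      graded_fuzzy_topsys_def dest: sys_homD(3))


section \<open>The adjunction\<close>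

definition swap_args :: "'x set \<Rightarrow> 'a set \<Rightarrow> ('x \<Rightarrow> 'a \<Rightarrow> 'c) \<Rightarrow> 'a \<Rightarrow> 'x \<Rightarrow> 'c" where
  "swap_args X A f = (\<lambda>a\<in>A. \<lambda>x\<in>X. f x a)"

lemma swap_args_involutive:
  assumes "f \<in> X \<rightarrow>\<^sub>E extensional A"
  shows "swap_args A X (swap_args X A f) = f"
proof (rule extensionalityI[of _ X])
  show "swap_args A X (swap_args X A f) \<in> extensional X"
    by (simp add: swap_args_def)
  show "f \<in> extensional X"
    using assms by (simp add: PiE_def)
  fix x assume x: "x \<in> X"
  then have "f x \<in> extensional A"
    using assms by auto
  with x show "swap_args A X (swap_args X A f) x = f x"
    by (auto simp: swap_args_def extensional_def fun_eq_iff)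
qed

lemma point_space_simps:
  "spts (omap (Ext_g \<circ>\<^sub>F S_g) A) = frm_hom A unit_frame"
  "sopens (omap (Ext_g \<circ>\<^sub>F S_g) A) = (\<lambda>a. \<lambda>v\<in>frm_hom A unit_frame. v a) ` fcarrier A"
  "amap (Ext_g \<circ>\<^sub>F S_g) A B h = (\<lambda>v\<in>frm_hom A unit_frame. compose (fcarrier B) v h)"
  by (auto simp: functor_comp_def Ext_g_def S_g_def ext_def[abs_def])

lemma opens_functor_simps:
  "omap (fm_g \<circ>\<^sub>F J_g) X = opens_frame X"
  "amap (fm_g \<circ>\<^sub>F J_g) X Y f = (\<lambda>T\<in>sopens Y. compose (spts X) T f)"
  by (auto simp: functor_comp_def fm_g_def J_g_def)

text \<open>With its arguments exchanged, \<open>f\<close> sends \<open>a\<close> to the preimage under \<open>f\<close> of the open set that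
  \<open>a\<close> determines on the space of points.  So continuity of \<open>f\<close> is openness of these values.\<close>

lemma top_hom_points_iff:
  "f \<in> top_hom X (omap (Ext_g \<circ>\<^sub>F S_g) A) \<longleftrightarrow>
    f \<in> spts X \<rightarrow>\<^sub>E frm_hom A unit_frame \<and>
    swap_args (spts X) (fcarrier A) f \<in> fcarrier A \<rightarrow>\<^sub>E sopens X"
proof -
  have "compose (spts X) (\<lambda>v\<in>frm_hom A unit_frame. v a) f = (\<lambda>x\<in>spts X. f x a)"
    if "f \<in> spts X \<rightarrow>\<^sub>E frm_hom A unit_frame" for a
    unfolding compose_def by (rule restrict_ext) (use that in auto)
  then show ?thesis
    by (auto simp: top_hom_def point_space_simps swap_args_def)
qed

lemma bij_betw_swap_args:
  assumes X: "fuzzy_space X" and A: "graded_frame A"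
  shows "bij_betw (swap_args (spts X) (fcarrier A))
    (top_hom X (omap (Ext_g \<circ>\<^sub>F S_g) A)) (frm_hom A (opens_frame X))"
proof (rule bij_betw_byWitness[where f' = "swap_args (fcarrier A) (spts X)"])
  have unit_ext: "v \<in> extensional (fcarrier A)" if "v \<in> frm_hom A unit_frame" for v
    using that by (simp add: frm_hom_unit_iff)
  have inv: "swap_args (fcarrier A) (spts X) (swap_args (spts X) (fcarrier A) f) = f"
    if "f \<in> spts X \<rightarrow>\<^sub>E frm_hom A unit_frame" for f
    using that unit_ext by (intro swap_args_involutive) (auto simp: PiE_def Pi_def)
  have inv': "swap_args (spts X) (fcarrier A) (swap_args (fcarrier A) (spts X) g) = g"
    if "g \<in> fcarrier A \<rightarrow>\<^sub>E sopens X" for g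
    using that fuzzy_spaceD(1)[OF X] by (intro swap_args_involutive) (auto simp: PiE_def Pi_def)
  show "\<forall>f\<in>top_hom X (omap (Ext_g \<circ>\<^sub>F S_g) A).
      swap_args (fcarrier A) (spts X) (swap_args (spts X) (fcarrier A) f) = f"
    using inv by (simp add: top_hom_points_iff)
  show "\<forall>g\<in>frm_hom A (opens_frame X).
      swap_args (spts X) (fcarrier A) (swap_args (fcarrier A) (spts X) g) = g"
    using inv' by (simp add: frm_hom_opens_iff[OF A X])
  show "swap_args (spts X) (fcarrier A) ` top_hom X (omap (Ext_g \<circ>\<^sub>F S_g) A)
      \<subseteq> frm_hom A (opens_frame X)"
  proof safe
    fix f assume "f \<in> top_hom X (omap (Ext_g \<circ>\<^sub>F S_g) A)"
    then have f: "f \<in> spts X \<rightarrow>\<^sub>E frm_hom A unit_frame"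
      and fo: "swap_args (spts X) (fcarrier A) f \<in> fcarrier A \<rightarrow>\<^sub>E sopens X"
      by (simp_all add: top_hom_points_iff)
    have "(\<lambda>a\<in>fcarrier A. swap_args (spts X) (fcarrier A) f a x) = f x" if "x \<in> spts X" for x
      using fun_cong[OF inv[OF f], of x] that by (simp add: swap_args_def[of "fcarrier A"])
    with f fo show "swap_args (spts X) (fcarrier A) f \<in> frm_hom A (opens_frame X)"
      by (auto simp: frm_hom_opens_iff[OF A X])
  qed
  show "swap_args (fcarrier A) (spts X) ` frm_hom A (opens_frame X)
      \<subseteq> top_hom X (omap (Ext_g \<circ>\<^sub>F S_g) A)"
  proof safe
    fix g assume "g \<in> frm_hom A (opens_frame X)"
    then have "g \<in> fcarrier A \<rightarrow>\<^sub>E sopens X"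
      and "\<forall>x\<in>spts X. (\<lambda>a\<in>fcarrier A. g a x) \<in> frm_hom A unit_frame"
      by (simp_all add: frm_hom_opens_iff[OF A X])
    then show "swap_args (fcarrier A) (spts X) g \<in> top_hom X (omap (Ext_g \<circ>\<^sub>F S_g) A)"
      by (simp add: top_hom_points_iff inv') (simp add: swap_args_def)
  qed
qed

text \<open>Both naturality squares are computed pointwise: going either way, the value at \<open>a\<close> and \<open>x\<close>
  is $f(g(x))(a)$ in the first and $f(x)(h(a))$ in the second.\<close>

lemma is_right_adjoint_points_opens:
  "is_right_adjoint
    (Ext_g \<circ>\<^sub>F S_g :: ('a gframe, 'a \<Rightarrow> 'a, ('a \<Rightarrow> unit_interval) fspace, _) prefunctor)
    (fm_g \<circ>\<^sub>F J_g :: ('x fspace, 'x \<Rightarrow> 'x, ('x \<Rightarrow> unit_interval) gframe, _) prefunctor)"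
  unfolding is_right_adjoint_def
proof (intro conjI exI[of _ "\<lambda>X A. swap_args (spts X) (fcarrier A)"] allI impI ballI)
  show "is_functor (op_cat Graded_Frm) Graded_Fuzzy_Top (Ext_g \<circ>\<^sub>F S_g)"
    by (rule is_functor_comp[OF is_functor_S_g is_functor_Ext_g])
  show "is_functor Graded_Fuzzy_Top (op_cat Graded_Frm) (fm_g \<circ>\<^sub>F J_g)"
    by (rule is_functor_comp[OF is_functor_J_g is_functor_fm_g])
next
  fix X :: "'x fspace" and A :: "'a gframe"
  assume "fuzzy_space X \<and> graded_frame A"
  then show "bij_betw (swap_args (spts X) (fcarrier A)) (top_hom X (omap (Ext_g \<circ>\<^sub>F S_g) A))
      (frm_hom A (omap (fm_g \<circ>\<^sub>F J_g) X))"
    unfolding opens_functor_simps by (simp add: bij_betw_swap_args)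
next
  fix X' X :: "'x fspace" and A :: "'a gframe" and g f
  assume g: "g \<in> top_hom X' X" and f: "f \<in> top_hom X (omap (Ext_g \<circ>\<^sub>F S_g) A)"
  from f have fo: "swap_args (spts X) (fcarrier A) f a \<in> sopens X" if "a \<in> fcarrier A" for a
    using that by (auto simp: top_hom_points_iff)
  have "swap_args (spts X') (fcarrier A) (compose (spts X') f g) a =
      compose (fcarrier A) (\<lambda>T\<in>sopens X. compose (spts X') T g)
        (swap_args (spts X) (fcarrier A) f) a" for a
    using fo[of a] top_homD(2)[OF g]
    by (cases "a \<in> fcarrier A")
      (auto simp: compose_eq compose_def[of "spts X'"] swap_args_def compose_def[of "fcarrier A"])
  then show "swap_args (spts X') (fcarrier A) (compose (spts X') f g) =
      compose (fcarrier A) (amap (fm_g \<circ>\<^sub>F J_g) X' X g) (swap_args (spts X) (fcarrier A) f)"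
    unfolding opens_functor_simps by blast
next
  fix X :: "'x fspace" and A B :: "'a gframe" and h f
  assume h: "h \<in> frm_hom B A" and f: "f \<in> top_hom X (omap (Ext_g \<circ>\<^sub>F S_g) A)"
  have "f x \<in> frm_hom A unit_frame" if "x \<in> spts X" for x
    using f that by (auto simp: top_hom_points_iff)
  then show "swap_args (spts X) (fcarrier B) (compose (spts X) (amap (Ext_g \<circ>\<^sub>F S_g) A B h) f) =
      compose (fcarrier B) (swap_args (spts X) (fcarrier A) f) h"
    using frm_homD(2)[OF h]
    by (auto simp: point_space_simps swap_args_def compose_def fun_eq_iff)
qed

theorem theorem7p4p2:
  shows "is_functor (op_cat Graded_Frm) Graded_Fuzzy_TopSys
      (S_g :: ('a gframe, 'a \<Rightarrow> 'a, ('a \<Rightarrow> unit_interval, 'a) ftopsys, _) prefunctor) \<and>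
    is_functor Graded_Fuzzy_TopSys Graded_Fuzzy_Top
      (Ext_g :: (('p, 'q) ftopsys, _, 'p fspace, 'p \<Rightarrow> 'p) prefunctor) \<and>
    is_functor Graded_Fuzzy_Top Graded_Fuzzy_TopSys
      (J_g :: ('x fspace, 'x \<Rightarrow> 'x, ('x, 'x \<Rightarrow> unit_interval) ftopsys, _) prefunctor) \<and>
    is_functor Graded_Fuzzy_TopSys (op_cat Graded_Frm)
      (fm_g :: (('p, 'q) ftopsys, _, 'q gframe, 'q \<Rightarrow> 'q) prefunctor) \<and>
    is_right_adjoint
      (Ext_g \<circ>\<^sub>F S_g :: ('a gframe, 'a \<Rightarrow> 'a, ('a \<Rightarrow> unit_interval) fspace, _) prefunctor)
      (fm_g \<circ>\<^sub>F J_g :: ('x fspace, 'x \<Rightarrow> 'x, ('x \<Rightarrow> unit_interval) gframe, _) prefunctor)"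
  by (intro conjI is_functor_S_g is_functor_Ext_g is_functor_J_g is_functor_fm_g
      is_right_adjoint_points_opens)

end
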